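(* Let $N$ be a finite set with $n:=|N|\geq 2$, and let $m:2^N\to\mathbb{R}$ be a non-zero standardized supermodular game over $N$. Let $\Gamma$ be a finite index set and let $x\in\mathbb{R}^{\Gamma\times N}$ be a real array such that the set of its rows $\{[x(\tau,i)]_{i\in N}:\tau\in\Gamma\}$ coincides with the set of vertices of the core $C(m)$ (rows may repeat). For $\tau\in\Gamma$ put $N_\tau:=\{i\in N: x(\tau,i)=0\}$ and $\mathcal{S}_\tau:=\{S\subseteq N: m(S)=\sum_{i\in S}x(\tau,i)\}$. Consider the following system of linear constraints on arrays $y\in\mathbb{R}^{\Gamma\times N}$: (a) for every $\tau\in\Gamma$ and every $i\in N_\tau$: $y(\tau,i)=0$; (b) for every $S\subseteq N$ and all $\tau,\pi\in\Gamma$ with $S\in\mathcal{S}_\tau\cap\mathcal{S}_\pi$: $\sum_{i\in S}y(\tau,i)=\sum_{i\in S}y(\pi,i)$. Then $m$ generates an extreme ray of the cone of standardized supermodular games over $N$ if and only if every real solution $y$ of (a)–(b) is a multiple of $x$, i.e., there is $\alpha\in\mathbb{R}$ with $y(\tau,i)=\alpha\cdot x(\tau,i)$ for all $\tau\in\Gamma$, $i\in N$.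
   Context: A game over $N$ is a function $m:2^N\to\mathbb{R}$ with $m(\emptyset)=0$. It is supermodular if $m(A)+m(B)\leq m(A\cup B)+m(A\cap B)$ for all $A,B\subseteq N$, and standardized if $m(S)=0$ whenever $|S|\leq 1$. The standardized supermodular games over $N$ form a pointed polyhedral cone in $\mathbb{R}^{2^N}$. The core of a game $m$ is $C(m):=\{v\in\mathbb{R}^N:\sum_{i\in N}v_i=m(N),\ \sum_{i\in S}v_i\geq m(S)\text{ for all }S\subseteq N\}$. *)

theory Defs
  imports "HOL-Analysis.Analysis"
begin

text \<open>
  The finite player set $N$ is the universe of a finite type \<^typ>\<open>'n\<close>, so that
  \<^typ>\<open>real ^ 'n\<close> is $R^N$, and a set function $2^N \to R$ is a vector indexed by
  \<^typ>\<open>'n set\<close>, i.e. an element of the Euclidean space $R^{2^N}$ containing the cone below.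
\<close>

type_synonym 'n set_fun = "real ^ ('n set)"

definition game :: "'n::finite set_fun \<Rightarrow> bool" where
  "game m \<longleftrightarrow> m $ {} = 0"

definition supermodular :: "'n::finite set_fun \<Rightarrow> bool" where
  "supermodular m \<longleftrightarrow> (\<forall>A B. m $ A + m $ B \<le> m $ (A \<union> B) + m $ (A \<inter> B))"

definition standardized :: "'n::finite set_fun \<Rightarrow> bool" where
  "standardized m \<longleftrightarrow> (\<forall>S. card S \<le> 1 \<longrightarrow> m $ S = 0)"

definition supermodular_cone :: "'n::finite set_fun set" where
  "supermodular_cone = {m. game m \<and> supermodular m \<and> standardized m}"

definition core :: "'n::finite set_fun \<Rightarrow> (real ^ 'n) set" where
  "core m = {v. (\<Sum>i\<in>UNIV. v $ i) = m $ UNIV \<and> (\<forall>S. (\<Sum>i\<in>S. v $ i) \<ge> m $ S)}"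

text \<open>
  The ray spanned by a non-zero \<open>v\<close>, origin included, is \<^term>\<open>conic hull {v}\<close>.
\<close>

definition generates_extreme_ray :: "'a::real_vector \<Rightarrow> 'a set \<Rightarrow> bool" where
  "generates_extreme_ray v K \<longleftrightarrow> v \<noteq> 0 \<and> (conic hull {v}) face_of K"

definition null_set :: "real ^ 'n ^ 'g \<Rightarrow> 'g \<Rightarrow> 'n::finite set" where
  "null_set x \<tau> = {i. x $ \<tau> $ i = 0}"

definition tight_sets :: "'n::finite set_fun \<Rightarrow> real ^ 'n ^ 'g \<Rightarrow> 'g \<Rightarrow> 'n set set" where
  "tight_sets m x \<tau> = {S. m $ S = (\<Sum>i\<in>S. x $ \<tau> $ i)}"

end

theory Submission imports Defs begin

text \<open>
  By Shapley's theorem the vertices of the core of a supermodular game are exactly its marginal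
  vectors, so the tight sets of every vertex contain a maximal chain.
  A decomposition \<open>m = a + b\<close> into supermodular games splits every vertex into the marginal vectors of
  \<open>a\<close> and \<open>b\<close> along such a chain; as both summands are in the respective cores, each set tight for
  the vertex is tight for the summands, which makes the first summands a solution of the system.
  Conversely, a solution \<open>y\<close> defines a set function \<open>w\<close> by \<open>w(S) = \<Sum>\<^sub>S y(\<tau>, \<cdot>)\<close> for any \<open>\<tau>\<close> having \<open>S\<close> as
  tight set, and \<open>m \<plusminus> \<epsilon>w\<close> stays supermodular for small \<open>\<epsilon>\<close>: if \<open>A\<close>, \<open>B\<close> satisfy
  the supermodular inequality with equality, then a vertex tight on \<open>A \<inter> B \<subseteq> A \<subseteq> A \<union> B\<close> is tight on
  \<open>B\<close>, so \<open>w\<close> satisfies it with equality, too.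
\<close>

section \<open>Uniform perturbations, and orders read off from families of sets\<close>

text \<open>Only finitely many ratios \<open>f a / \<bar>g a\<bar>\<close> with
  \<open>g a \<noteq> 0\<close> matter, and each is positive. With \<open>f\<close> the slack of an
  inequality, the lemma permits a perturbation by both \<open>\<epsilon> * g\<close> and its
  negative.\<close>

lemma ex_uniform_scale:
  fixes f g :: "'a::finite \<Rightarrow> real"
  assumes "\<And>a. 0 \<le> f a" and "\<And>a. f a = 0 \<Longrightarrow> g a = 0"
  obtains \<epsilon> where "\<epsilon> > 0" and "\<And>a. \<epsilon> * \<bar>g a\<bar> \<le> f a"
proof -
  have "\<exists>\<epsilon>>0. \<forall>a\<in>A. \<epsilon> * \<bar>g a\<bar> \<le> f a" if "finite A" for A
    using that
  proof (induction A)
    case empty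
    show ?case by (auto intro: exI[of _ 1])
  next
    case (insert a A)
    then obtain \<epsilon> where e: "\<epsilon> > 0" "\<forall>a\<in>A. \<epsilon> * \<bar>g a\<bar> \<le> f a" by blast
    obtain \<delta> where d: "\<delta> > 0" "\<delta> * \<bar>g a\<bar> \<le> f a"
    proof (cases "g a = 0")
      case True
      then show ?thesis using that[of 1] assms(1) by simp
    next
      case False
      then have "f a > 0" using assms by (metis order_le_less)
      then show ?thesis using that[of "f a / \<bar>g a\<bar>"] False by simp
    qed
    have "min \<epsilon> \<delta> * \<bar>g b\<bar> \<le> f b" if "b \<in> insert a A" for b
      using that e(2) d(2) mult_right_mono[of "min \<epsilon> \<delta>" \<epsilon> "\<bar>g b\<bar>"]
        mult_right_mono[of "min \<epsilon> \<delta>" \<delta> "\<bar>g b\<bar>"] by force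
    then show ?case using e(1) d(1) by (intro exI[of _ "min \<epsilon> \<delta>"]) auto
  qed
  from this[OF finite[of UNIV]] obtain \<epsilon> where \<epsilon>: "\<epsilon> > 0" "\<forall>a\<in>UNIV. \<epsilon> * \<bar>g a\<bar> \<le> f a"
    by (elim exE conjE)
  show ?thesis by (rule that[OF \<epsilon>(1) bspec[OF \<epsilon>(2) UNIV_I]])
qed

text \<open>A smallest member of \<open>L\<close> properly above \<open>T\<close> has exactly one
  new element, because separation would cut a larger one down. Growing from the empty set therefore
  yields a maximal chain in \<open>L\<close>, and \<open>r\<close> records the order in which
  elements enter.\<close>

lemma rank_of_lattice:
  fixes L :: "'n::finite set set"
  assumes "{} \<in> L" "UNIV \<in> L"
    and Un: "\<And>A B. A \<in> L \<Longrightarrow> B \<in> L \<Longrightarrow> A \<union> B \<in> L"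
    and Int: "\<And>A B. A \<in> L \<Longrightarrow> B \<in> L \<Longrightarrow> A \<inter> B \<in> L"
    and sep: "\<And>i j. i \<noteq> j \<Longrightarrow> \<exists>T\<in>L. (i \<in> T) \<noteq> (j \<in> T)"
  obtains r :: "'n \<Rightarrow> nat" where "inj r" and "\<And>k. {j. r j < k} \<in> L"
proof -
  have step: "\<exists>i. i \<notin> T \<and> insert i T \<in> L" if T: "T \<in> L" "T \<noteq> UNIV" for T
  proof -
    define B where "B = (ARG_MIN card B. B \<in> L \<and> T \<subset> B)"
    have "UNIV \<in> L \<and> T \<subset> UNIV" using assms(2) T(2) by auto
    from arg_min_nat_lemma[of "\<lambda>B. B \<in> L \<and> T \<subset> B", OF this, of card]
    have B: "B \<in> L" "T \<subset> B" and min: "\<And>C. C \<in> L \<Longrightarrow> T \<subset> C \<Longrightarrow> card B \<le> card C"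
      unfolding B_def by auto
    obtain i where i: "i \<in> B" "i \<notin> T" using B(2) by blast
    have "B = insert i T"
    proof (rule ccontr)
      assume "B \<noteq> insert i T"
      then obtain j where j: "j \<in> B" "j \<notin> T" "i \<noteq> j" using i B(2) by blast
      then obtain U where U: "U \<in> L" "(i \<in> U) \<noteq> (j \<in> U)" using sep by blast
      \<comment> \<open>Exactly one of \<open>i\<close> and \<open>j\<close> lies in
        \<open>?C\<close>, so it is strictly between \<open>T\<close> and \<open>B\<close>.\<close>
      let ?C = "U \<inter> B \<union> T"
      have "?C \<in> L" using U T B Un Int by blast
      moreover have "T \<subset> ?C" "?C \<subset> B" using U i j B(2) by blast+
      ultimately show False using min[of ?C] psubset_card_mono[of B ?C] by simp
    qed
    then show ?thesis using i B by blast
  qed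
  have "\<exists>T r. T \<in> L \<and> card T = n \<and> inj_on r T \<and> (\<forall>j\<in>T. r j < n) \<and> (\<forall>k::nat. {j\<in>T. r j < k} \<in> L)"
    if "n \<le> CARD('n)" for n
    using that
  proof (induction n)
    case 0
    then show ?case using assms(1) by (intro exI[of _ "{}"]) auto
  next
    case (Suc n)
    then obtain T r where T: "T \<in> L" "card T = n" and inj: "inj_on r T" and bound: "\<forall>j\<in>T. r j < n"
      and seg: "\<forall>k::nat. {j\<in>T. r j < k} \<in> L" by auto
    have "T \<noteq> UNIV" using T(2) Suc.prems by auto
    then obtain i where i: "i \<notin> T" "insert i T \<in> L" using step T by blast
    \<comment> \<open>All earlier ranks are below \<open>n\<close>, so \<open>i\<close> comes last
      and the segments up to \<open>n\<close> stay as they were.\<close>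
    let ?r = "r(i := n)"
    have seg': "{j \<in> insert i T. ?r j < k} \<in> L" for k
    proof (cases "n < k")
      case True
      then have "{j \<in> insert i T. ?r j < k} = insert i T" using bound by force
      then show ?thesis using i by simp
    next
      case False
      then have "{j \<in> insert i T. ?r j < k} = {j\<in>T. r j < k}" using i by auto
      then show ?thesis using seg by simp
    qed
    have "inj_on ?r (insert i T)" using inj bound i by (auto simp: inj_on_def)
    moreover have "\<forall>j\<in>insert i T. ?r j < Suc n" using bound by (auto simp: less_Suc_eq)
    moreover have "card (insert i T) = Suc n" using i T by simp
    ultimately show ?case using i(2) seg' by blast
  qed
  from this[OF order_refl] obtain T and r :: "'n \<Rightarrow> nat" where
    "card T = CARD('n)" and r: "inj_on r T" "\<forall>k. {j\<in>T. r j < k} \<in> L"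
    by (elim exE conjE)
  then have T: "T = UNIV" using card_subset_eq[OF finite subset_UNIV] by blast
  show ?thesis
  proof (rule that)
    show "inj r" using r(1) T by simp
    show "{j. r j < k} \<in> L" for k using spec[OF r(2), of k] T by simp
  qed
qed

lemma rank_through_chain:
  fixes P Q R :: "'n::finite set"
  assumes "P \<subseteq> Q" "Q \<subseteq> R"
  obtains r :: "'n \<Rightarrow> nat" where "inj r"
    and "P \<in> range (\<lambda>k. {j. r j < k})" "Q \<in> range (\<lambda>k. {j. r j < k})" "R \<in> range (\<lambda>k. {j. r j < k})"
proof -
  obtain q :: "'n \<Rightarrow> nat" where "inj q"
    using finite_imp_inj_to_nat_seg[of "UNIV :: 'n set"] by auto
  define K where "K = Suc (Max (range q))"
  have K: "q j < K" for j unfolding K_def by (simp add: le_imp_less_Suc)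
  \<comment> \<open>Since \<open>q\<close> stays below \<open>K\<close>, the blocks
    \<open>P\<close>, \<open>Q - P\<close>, \<open>R - Q\<close> and the remainder get ranks in
    consecutive disjoint intervals of length \<open>K\<close>.\<close>
  define r where
    "r j = q j + (if j \<in> P then 0 else if j \<in> Q then K else if j \<in> R then 2 * K else 3 * K)" for j
  have "inj r"
  proof (rule injI)
    fix i j assume "r i = r j"
    then have "q i = q j" using K[of i] K[of j] by (auto simp: r_def split: if_splits)
    then show "i = j" using \<open>inj q\<close> by (simp add: injD)
  qed
  moreover have "P = {j. r j < K}" "Q = {j. r j < 2 * K}" "R = {j. r j < 3 * K}"
  proof -
    have "(j \<in> P) = (r j < K) \<and> (j \<in> Q) = (r j < 2 * K) \<and> (j \<in> R) = (r j < 3 * K)" for j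
      using K[of j] assms by (auto simp: r_def)
    then show "P = {j. r j < K}" "Q = {j. r j < 2 * K}" "R = {j. r j < 3 * K}" by auto
  qed
  ultimately show ?thesis using that by blast
qed

section \<open>Marginal vectors and the core\<close>

text \<open>This is the marginal (greedy) vector of a linear order on the players. The order is
  given by an injective rank \<open>r\<close>, whose values may have gaps.\<close>

definition marginal :: "('n \<Rightarrow> nat) \<Rightarrow> 'n::finite set_fun \<Rightarrow> real ^ 'n" where
  "marginal r m = (\<chi> i. m $ {j. r j \<le> r i} - m $ {j. r j < r i})"

lemma marginal_add: "marginal r (a + b) = marginal r a + marginal r b"
  by (simp add: marginal_def vec_eq_iff)

lemma sum_segment_Suc:
  fixes v :: "real ^ 'n::finite"
  assumes "inj r"
  shows "(\<Sum>i\<in>{j. r j < Suc (r k)}. v $ i) = v $ k + (\<Sum>i\<in>{j. r j < r k}. v $ i)"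
proof -
  have "{j. r j < Suc (r k)} = insert k {j. r j < r k}"
    using assms by (auto simp: less_Suc_eq dest: injD)
  then show ?thesis by simp
qed

text \<open>Two successive segments around the rank of \<open>k\<close> differ by the single player
  \<open>k\<close>, so differences of segment sums recover every coordinate.\<close>

lemma eq_if_segment_sums_eq:
  fixes u v :: "real ^ 'n::finite" and r :: "'n \<Rightarrow> nat"
  assumes "inj r" and "\<And>k. (\<Sum>i\<in>{j. r j < k}. u $ i) = (\<Sum>i\<in>{j. r j < k}. v $ i)"
  shows "u = v"
  using sum_segment_Suc[OF assms(1), of u] sum_segment_Suc[OF assms(1), of v] assms(2)
  by (metis add_right_cancel vec_eq_iff)

lemma sum_marginal_segment:
  assumes "game m" "inj r"
  shows "(\<Sum>i\<in>{j. r j < k}. marginal r m $ i) = m $ {j. r j < k}"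
proof (induction k)
  case 0
  then show ?case using assms(1) by (simp add: game_def)
next
  case (Suc k)
  show ?case
  proof (cases "\<exists>i. r i = k")
    case True
    then obtain i where "k = r i" by blast
    then show ?thesis
      using Suc sum_segment_Suc[OF assms(2), of "marginal r m" i] by (simp add: marginal_def less_Suc_eq_le)
  next
    \<comment> \<open>The rank \<open>k\<close> is not attained, so the segment does not
      grow.\<close>
    case False
    then have "{j. r j < Suc k} = {j. r j < k}" by (auto simp: less_Suc_eq)
    then show ?thesis using Suc by simp
  qed
qed

text \<open>The set is built up in the order of \<open>r\<close>. By supermodularity, the gain of
  adding \<open>x\<close> to \<open>S\<close> is at most the gain of adding it to the larger set of
  all its predecessors, which is the marginal coordinate.\<close>

lemma sum_marginal_ge:
  fixes m :: "'n::finite set_fun"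
  assumes "game m" "supermodular m" "inj r"
  shows "m $ S \<le> (\<Sum>i\<in>S. marginal r m $ i)"
proof -
  have "finite S" by simp
  then show ?thesis
  proof (induction S rule: finite_ranking_induct[where f = r])
    case empty
    then show ?case using assms(1) by (simp add: game_def)
  next
    case (insert x S)
    show ?case
    proof (cases "x \<in> S")
      case True
      then show ?thesis using insert.IH by (simp add: insert_absorb)
    next
      case False
      have sub: "S \<subseteq> {j. r j < r x}"
        using insert.hyps False assms(3) by (auto simp: order_le_less dest: injD)
      have "{j. r j \<le> r x} = insert x {j. r j < r x}"
        using assms(3) by (auto simp: order_le_less dest: injD)
      then have "insert x S \<union> {j. r j < r x} = {j. r j \<le> r x}" "insert x S \<inter> {j. r j < r x} = S"
        using sub by auto
      then have "m $ insert x S + m $ {j. r j < r x} \<le> m $ {j. r j \<le> r x} + m $ S"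
        using assms(2) unfolding supermodular_def by metis
      then show ?thesis using insert.IH False by (simp add: marginal_def)
    qed
  qed
qed

lemma marginal_in_core:
  fixes m :: "'n::finite set_fun"
  assumes "game m" "supermodular m" "inj r"
  shows "marginal r m \<in> core m"
proof -
  have "UNIV = {j. r j < Suc (Max (range r))}" by (auto simp: less_Suc_eq_le)
  then have "(\<Sum>i\<in>UNIV. marginal r m $ i) = m $ UNIV"
    using sum_marginal_segment[OF assms(1,3)] by metis
  then show ?thesis using sum_marginal_ge[OF assms] by (simp add: core_def)
qed

text \<open>Every initial segment is tight here. On such a segment the excesses of two core elements
  are nonnegative and have a vanishing proper convex combination, so both vanish; the segment sums
  then determine both elements.\<close>

lemma marginal_extreme_point:
  fixes m :: "'n::finite set_fun"
  assumes "game m" "supermodular m" "inj r"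
  shows "marginal r m extreme_point_of core m"
  unfolding extreme_point_of_def
proof (intro conjI ballI notI)
  show "marginal r m \<in> core m" using marginal_in_core[OF assms] .
next
  fix a b assume ab: "a \<in> core m" "b \<in> core m" and "marginal r m \<in> open_segment a b"
  then obtain u where "a \<noteq> b" and u: "0 < u" "u < 1" and eq: "marginal r m = (1 - u) *\<^sub>R a + u *\<^sub>R b"
    unfolding in_segment by blast
  have "a = b"
  proof (rule eq_if_segment_sums_eq[OF assms(3)])
    fix k
    let ?S = "{j. r j < k}"
    let ?a = "(\<Sum>i\<in>?S. a $ i) - m $ ?S" and ?b = "(\<Sum>i\<in>?S. b $ i) - m $ ?S"
    have ge: "0 \<le> ?a" "0 \<le> ?b" using ab by (auto simp: core_def)
    have "m $ ?S = (\<Sum>i\<in>?S. ((1 - u) *\<^sub>R a + u *\<^sub>R b) $ i)"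
      using sum_marginal_segment[OF assms(1,3)] eq by simp
    also have "\<dots> = (1 - u) * (\<Sum>i\<in>?S. a $ i) + u * (\<Sum>i\<in>?S. b $ i)"
      by (simp add: sum.distrib sum_distrib_left)
    finally have "(1 - u) * ?a + u * ?b = 0" by (simp add: algebra_simps)
    moreover have "0 \<le> (1 - u) * ?a" "0 \<le> u * ?b" using u ge by auto
    ultimately have "(1 - u) * ?a = 0" "u * ?b = 0" by linarith+
    then have "?a = 0" "?b = 0" using u by auto
    then show "(\<Sum>i\<in>?S. a $ i) = (\<Sum>i\<in>?S. b $ i)" by simp
  qed
  then show False using \<open>a \<noteq> b\<close> by simp
qed

section \<open>Tight sets at extreme points of the core\<close>

text \<open>The excess of the additive \<open>v\<close> over \<open>m\<close> is submodular and
  nonnegative, so its zeros are closed under union and intersection.\<close>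

lemma tight_Un_Int:
  fixes m :: "'n::finite set_fun"
  assumes "supermodular m" "v \<in> core m"
    and "m $ A = (\<Sum>i\<in>A. v $ i)" "m $ B = (\<Sum>i\<in>B. v $ i)"
  shows "m $ (A \<union> B) = (\<Sum>i\<in>A \<union> B. v $ i)" "m $ (A \<inter> B) = (\<Sum>i\<in>A \<inter> B. v $ i)"
proof -
  have "(\<Sum>i\<in>A \<union> B. v $ i) + (\<Sum>i\<in>A \<inter> B. v $ i) = (\<Sum>i\<in>A. v $ i) + (\<Sum>i\<in>B. v $ i)"
    by (simp add: sum.union_inter)
  moreover have "m $ A + m $ B \<le> m $ (A \<union> B) + m $ (A \<inter> B)"
    using assms(1) by (simp add: supermodular_def)
  moreover have "m $ (A \<union> B) \<le> (\<Sum>i\<in>A \<union> B. v $ i)" "m $ (A \<inter> B) \<le> (\<Sum>i\<in>A \<inter> B. v $ i)"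
    using assms(2) by (simp_all add: core_def)
  ultimately show "m $ (A \<union> B) = (\<Sum>i\<in>A \<union> B. v $ i)" "m $ (A \<inter> B) = (\<Sum>i\<in>A \<inter> B. v $ i)"
    using assms(3,4) by linarith+
qed

text \<open>Otherwise a small transfer between \<open>i\<close> and \<open>j\<close>, in either
  direction, changes no tight sum and uses only slack elsewhere, so \<open>v\<close> is the midpoint
  of a segment in the core.\<close>

lemma extreme_point_tight_separates:
  fixes m :: "'n::finite set_fun"
  assumes ext: "v extreme_point_of core m" and "i \<noteq> j"
  shows "\<exists>T. m $ T = (\<Sum>l\<in>T. v $ l) \<and> (i \<in> T) \<noteq> (j \<in> T)"
proof (rule ccontr)
  assume *: "\<not> ?thesis"
  have v: "v \<in> core m" using ext by (simp add: extreme_point_of_def)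
  define d :: "real ^ 'n" where "d = axis i 1 - axis j 1"
  have sum_d: "(\<Sum>l\<in>T. d $ l) = (if i \<in> T then 1 else 0) - (if j \<in> T then 1 else 0)" for T
    by (simp add: d_def axis_def sum_subtractf)
  obtain \<epsilon> where e: "\<epsilon> > 0" "\<And>T. \<epsilon> * \<bar>\<Sum>l\<in>T. d $ l\<bar> \<le> (\<Sum>l\<in>T. v $ l) - m $ T"
    using ex_uniform_scale[of "\<lambda>T. (\<Sum>l\<in>T. v $ l) - m $ T" "\<lambda>T. \<Sum>l\<in>T. d $ l"] v * sum_d
    by (auto simp: core_def)
  have in_core: "v + s *\<^sub>R d \<in> core m" if "\<bar>s\<bar> = \<epsilon>" for s
  proof -
    have sum_vd: "(\<Sum>l\<in>T. (v + s *\<^sub>R d) $ l) = (\<Sum>l\<in>T. v $ l) + s * (\<Sum>l\<in>T. d $ l)" for T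
      by (simp add: sum.distrib sum_distrib_left)
    have "m $ T \<le> (\<Sum>l\<in>T. (v + s *\<^sub>R d) $ l)" for T
    proof -
      have "\<bar>s * (\<Sum>l\<in>T. d $ l)\<bar> \<le> (\<Sum>l\<in>T. v $ l) - m $ T" using e(2) that by (simp add: abs_mult)
      then show ?thesis unfolding sum_vd by linarith
    qed
    moreover have "(\<Sum>l\<in>UNIV. (v + s *\<^sub>R d) $ l) = m $ UNIV"
      unfolding sum_vd sum_d using v by (simp add: core_def)
    ultimately show ?thesis by (simp add: core_def)
  qed
  have "d $ i \<noteq> 0" using \<open>i \<noteq> j\<close> by (simp add: d_def axis_def)
  then have "d \<noteq> 0" by auto
  moreover have "(v + \<epsilon> *\<^sub>R d) - (v + (- \<epsilon>) *\<^sub>R d) = (2 * \<epsilon>) *\<^sub>R d" by (simp add: scaleR_2[symmetric])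
  ultimately have ne: "v + (- \<epsilon>) *\<^sub>R d \<noteq> v + \<epsilon> *\<^sub>R d" using e(1) by auto
  have "midpoint (v + (- \<epsilon>) *\<^sub>R d) (v + \<epsilon> *\<^sub>R d) = v" by (simp add: midpoint_def scaleR_2[symmetric])
  then have "v \<in> open_segment (v + (- \<epsilon>) *\<^sub>R d) (v + \<epsilon> *\<^sub>R d)"
    using ne by (metis midpoint_in_open_segment)
  then show False using ext in_core[of "- \<epsilon>"] in_core[of \<epsilon>] e(1) unfolding extreme_point_of_def by auto
qed

text \<open>The tight sets form a lattice that separates players, hence contain a maximal chain.
  This is the half of Shapley's theorem by which every vertex is a marginal vector.\<close>

lemma extreme_point_tight_rank:
  fixes m :: "'n::finite set_fun"
  assumes "game m" "supermodular m" and ext: "v extreme_point_of core m"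
  obtains r :: "'n \<Rightarrow> nat" where "inj r" "\<And>k. m $ {j. r j < k} = (\<Sum>i\<in>{j. r j < k}. v $ i)"
proof -
  note thesisI = that
  let ?L = "{T. m $ T = (\<Sum>i\<in>T. v $ i)}"
  have v: "v \<in> core m" using ext by (simp add: extreme_point_of_def)
  show ?thesis
  proof (rule rank_of_lattice[of ?L])
    show "{} \<in> ?L" "UNIV \<in> ?L" using v assms(1) by (auto simp: core_def game_def)
    show "A \<union> B \<in> ?L" "A \<inter> B \<in> ?L" if "A \<in> ?L" "B \<in> ?L" for A B
      using tight_Un_Int[OF assms(2) v, of A B] that by auto
    show "\<exists>T\<in>?L. (i \<in> T) \<noteq> (j \<in> T)" if "i \<noteq> j" for i j
      using extreme_point_tight_separates[OF ext that] by blast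
    show thesis if r: "inj r" "\<And>k. {j. r j < k} \<in> ?L" for r :: "'n \<Rightarrow> nat"
    proof (rule thesisI[OF r(1)])
      show "m $ {j. r j < k} = (\<Sum>i\<in>{j. r j < k}. v $ i)" for k using r(2)[of k] by simp
    qed
  qed
qed

text \<open>The marginal vector of an order having all three sets as initial segments does
  it.\<close>

lemma extreme_point_through_chain:
  fixes m :: "'n::finite set_fun"
  assumes "game m" "supermodular m" "P \<subseteq> Q" "Q \<subseteq> R"
  obtains v where "v extreme_point_of core m" "m $ P = (\<Sum>i\<in>P. v $ i)"
    "m $ Q = (\<Sum>i\<in>Q. v $ i)" "m $ R = (\<Sum>i\<in>R. v $ i)"
proof -
  obtain r :: "'n \<Rightarrow> nat" where r: "inj r"
    "P \<in> range (\<lambda>k. {j. r j < k})" "Q \<in> range (\<lambda>k. {j. r j < k})" "R \<in> range (\<lambda>k. {j. r j < k})"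
    using rank_through_chain[OF assms(3,4)] by blast
  have tight: "m $ S = (\<Sum>i\<in>S. marginal r m $ i)" if "S \<in> range (\<lambda>k. {j. r j < k})" for S
    using that sum_marginal_segment[OF assms(1) r(1)] by auto
  show ?thesis
    by (rule that[OF marginal_extreme_point[OF assms(1,2) r(1)] tight[OF r(2)] tight[OF r(3)] tight[OF r(4)]])
qed

section \<open>Signs and scaling in the cone\<close>

text \<open>Adding a player never lowers the value, as singletons and the empty set have value 0.
  This later fixes the sign of scalars and excludes cancellation in sums.\<close>

lemma supermodular_cone_nonneg:
  assumes "m \<in> supermodular_cone"
  shows "0 \<le> m $ S"
proof -
  have m: "supermodular m" "\<And>T. card T \<le> 1 \<Longrightarrow> m $ T = 0"
    using assms by (auto simp: supermodular_cone_def standardized_def)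
  have "finite S" by simp
  then show ?thesis
  proof (induction S)
    case empty
    then show ?case using m(2)[of "{}"] by simp
  next
    case (insert i S)
    have "m $ {i} + m $ S \<le> m $ ({i} \<union> S) + m $ ({i} \<inter> S)"
      using m(1) unfolding supermodular_def by blast
    then show ?case using insert m(2)[of "{i}"] m(2)[of "{}"] by simp
  qed
qed

lemma supermodular_cone_scaleR:
  assumes "m \<in> supermodular_cone" "0 \<le> c"
  shows "c *\<^sub>R m \<in> supermodular_cone"
  using assms
  by (auto simp: supermodular_cone_def game_def standardized_def supermodular_def
      distrib_left[symmetric] intro!: mult_left_mono)

lemma conic_hull_singleton_eq: "conic hull {m} = {c *\<^sub>R m | c. 0 \<le> c}"
  by (auto simp: conic_hull_explicit)

section \<open>The linear system given by the vertices of the core\<close>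

locale core_vertices =
  fixes m :: "'n::finite set_fun" and x :: "real ^ 'n ^ 'g::finite"
  assumes game: "game m" and supermod: "supermodular m" and stand: "standardized m"
    and rows: "rows x = {v. v extreme_point_of core m}"
begin

lemma m_in_cone: "m \<in> supermodular_cone"
  using game supermod stand by (simp add: supermodular_cone_def)

lemma extreme_point_row: "x $ \<tau> extreme_point_of core m"
proof -
  have "x $ \<tau> \<in> rows x" by (auto simp: rows_def row_def)
  then show ?thesis using rows by simp
qed

lemma row_of_extreme_point:
  assumes "v extreme_point_of core m"
  obtains \<tau> where "v = x $ \<tau>"
proof -
  have "v \<in> rows x" using assms rows by simp
  then show ?thesis using that by (auto simp: rows_def row_def)
qed

text \<open>Used with \<open>P = Q = R\<close>, it shows that every set is tight at some
  row.\<close>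

lemma tight_chain:
  assumes "P \<subseteq> Q" "Q \<subseteq> R"
  obtains \<tau> where "P \<in> tight_sets m x \<tau>" "Q \<in> tight_sets m x \<tau>" "R \<in> tight_sets m x \<tau>"
proof -
  obtain v where v: "v extreme_point_of core m" "m $ P = (\<Sum>i\<in>P. v $ i)"
    "m $ Q = (\<Sum>i\<in>Q. v $ i)" "m $ R = (\<Sum>i\<in>R. v $ i)"
    using extreme_point_through_chain[OF game supermod assms] .
  obtain \<tau> where "v = x $ \<tau>" using row_of_extreme_point[OF v(1)] .
  then show ?thesis using that[of \<tau>] v by (simp add: tight_sets_def)
qed

lemma tight_rank:
  obtains r :: "'n \<Rightarrow> nat" where "inj r" "\<And>k. {j. r j < k} \<in> tight_sets m x \<tau>"
proof -
  obtain r :: "'n \<Rightarrow> nat"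
    where "inj r" "\<And>k. m $ {j. r j < k} = (\<Sum>i\<in>{j. r j < k}. x $ \<tau> $ i)"
    using extreme_point_tight_rank[OF game supermod extreme_point_row] by blast
  then show ?thesis using that[of r] by (simp add: tight_sets_def)
qed

text \<open>Through this, condition (a) becomes a condition on tight singletons.\<close>

lemma singleton_tight_iff: "{i} \<in> tight_sets m x \<tau> \<longleftrightarrow> i \<in> null_set x \<tau>"
  using stand by (auto simp: tight_sets_def null_set_def standardized_def)

text \<open>Conditions (a) and (b), worded exactly as in the final theorem so that they can be
  folded there.\<close>

definition solution :: "real ^ 'n ^ 'g \<Rightarrow> bool" where
  "solution y \<longleftrightarrow> (\<forall>\<tau>. \<forall>i \<in> null_set x \<tau>. y $ \<tau> $ i = 0) \<and>
       (\<forall>S \<tau> \<pi>. S \<in> tight_sets m x \<tau> \<inter> tight_sets m x \<pi> \<longrightarrow>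
          (\<Sum>i\<in>S. y $ \<tau> $ i) = (\<Sum>i\<in>S. y $ \<pi> $ i))"

lemma solution_sum_eq:
  assumes "solution y" "S \<in> tight_sets m x \<tau>" "S \<in> tight_sets m x \<pi>"
  shows "(\<Sum>i\<in>S. y $ \<tau> $ i) = (\<Sum>i\<in>S. y $ \<pi> $ i)"
  using assms unfolding solution_def by blast

section \<open>Extremality from uniqueness of solutions\<close>

lemma solution_of_summand:
  assumes "a \<in> supermodular_cone" "b \<in> supermodular_cone" "m = a + b"
  obtains y where "solution y" "\<And>S \<tau>. S \<in> tight_sets m x \<tau> \<Longrightarrow> (\<Sum>i\<in>S. y $ \<tau> $ i) = a $ S"
proof -
  have ab: "game a" "supermodular a" "standardized a" "game b" "supermodular b"
    using assms by (auto simp: supermodular_cone_def)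
  have "\<forall>\<tau>. \<exists>r :: 'n \<Rightarrow> nat. inj r \<and> (\<forall>k. {j. r j < k} \<in> tight_sets m x \<tau>)"
    using tight_rank by metis
  then obtain r :: "'g \<Rightarrow> 'n \<Rightarrow> nat" where r: "\<And>\<tau>. inj (r \<tau>)" "\<And>\<tau> k. {j. r \<tau> j < k} \<in> tight_sets m x \<tau>"
    by metis
  define y :: "real ^ 'n ^ 'g" where "y = (\<chi> \<tau>. marginal (r \<tau>) a)"
  have sum_y: "(\<Sum>i\<in>S. y $ \<tau> $ i) = a $ S" if S: "S \<in> tight_sets m x \<tau>" for S \<tau>
  proof -
    \<comment> \<open>Both vectors have the same sums on the segments of \<open>r \<tau>\<close>,
      all of which are tight.\<close>
    have "x $ \<tau> = marginal (r \<tau>) m"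
      using r(2)[of \<tau>] sum_marginal_segment[OF game r(1)]
      by (intro eq_if_segment_sums_eq[OF r(1)[of \<tau>]]) (simp add: tight_sets_def)
    also have "\<dots> = marginal (r \<tau>) a + marginal (r \<tau>) b" using assms(3) marginal_add by simp
    finally have "(\<Sum>i\<in>S. x $ \<tau> $ i) = (\<Sum>i\<in>S. marginal (r \<tau>) a $ i) + (\<Sum>i\<in>S. marginal (r \<tau>) b $ i)"
      by (simp add: sum.distrib)
    \<comment> \<open>These two lower bounds add up to an equality on the tight set
      \<open>S\<close>, so each is an equality.\<close>
    moreover have "a $ S \<le> (\<Sum>i\<in>S. marginal (r \<tau>) a $ i)" "b $ S \<le> (\<Sum>i\<in>S. marginal (r \<tau>) b $ i)"
      using sum_marginal_ge ab r(1) by blast+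
    moreover have "(\<Sum>i\<in>S. x $ \<tau> $ i) = a $ S + b $ S" using S assms(3) by (simp add: tight_sets_def)
    ultimately show ?thesis by (simp add: y_def)
  qed
  moreover have "solution y"
    unfolding solution_def
  proof (intro conjI allI ballI impI)
    fix \<tau> i assume "i \<in> null_set x \<tau>"
    then show "y $ \<tau> $ i = 0"
      using sum_y[of "{i}" \<tau>] ab(3) by (simp add: singleton_tight_iff standardized_def)
  qed (auto simp: sum_y)
  ultimately show ?thesis using that by blast
qed

text \<open>The solution obtained from \<open>a\<close> is a multiple of \<open>x\<close>; since
  every set is tight at some row, \<open>a\<close> is the same multiple of \<open>m\<close>. A set
  of positive value shows that the factor is nonnegative.\<close>

lemma summand_is_multiple:
  assumes only: "\<And>y. solution y \<Longrightarrow> \<exists>\<alpha>. \<forall>\<tau> i. y $ \<tau> $ i = \<alpha> * x $ \<tau> $ i"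
    and "m \<noteq> 0" and ab: "a \<in> supermodular_cone" "b \<in> supermodular_cone" "m = a + b"
  shows "a \<in> conic hull {m}"
proof -
  obtain y where y: "solution y" "\<And>S \<tau>. S \<in> tight_sets m x \<tau> \<Longrightarrow> (\<Sum>i\<in>S. y $ \<tau> $ i) = a $ S"
    using solution_of_summand[OF ab] by blast
  obtain \<alpha> where \<alpha>: "\<And>\<tau> i. y $ \<tau> $ i = \<alpha> * x $ \<tau> $ i" using only[OF y(1)] by blast
  have a: "a $ S = \<alpha> * m $ S" for S
  proof -
    obtain \<tau> where "S \<in> tight_sets m x \<tau>" using tight_chain[of S S S] by auto
    then show ?thesis using y(2)[of S \<tau>] by (simp add: \<alpha> tight_sets_def sum_distrib_left)
  qed
  obtain S where "m $ S \<noteq> 0" using \<open>m \<noteq> 0\<close> by (auto simp: vec_eq_iff)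
  then have "0 < m $ S" using supermodular_cone_nonneg[OF m_in_cone, of S] by simp
  moreover have "0 \<le> \<alpha> * m $ S" using supermodular_cone_nonneg[OF ab(1), of S] a by simp
  ultimately have "0 \<le> \<alpha>" by (simp add: zero_le_mult_iff)
  moreover have "a = \<alpha> *\<^sub>R m" by (simp add: vec_eq_iff a)
  ultimately show ?thesis by (auto simp: conic_hull_singleton_eq)
qed

text \<open>Division by \<open>c\<close> reduces this to a decomposition of \<open>m\<close> itself.
  For \<open>c = 0\<close> the nonnegative summands cannot cancel, so \<open>a\<close> is
  zero.\<close>

lemma summand_of_multiple_is_multiple:
  assumes only: "\<And>y. solution y \<Longrightarrow> \<exists>\<alpha>. \<forall>\<tau> i. y $ \<tau> $ i = \<alpha> * x $ \<tau> $ i"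
    and "m \<noteq> 0" and ab: "a \<in> supermodular_cone" "b \<in> supermodular_cone"
    and s: "0 < s" "0 < t" and sum: "s *\<^sub>R a + t *\<^sub>R b \<in> conic hull {m}"
  shows "a \<in> conic hull {m}"
proof -
  obtain c where c: "0 \<le> c" "s *\<^sub>R a + t *\<^sub>R b = c *\<^sub>R m" using sum by (auto simp: conic_hull_singleton_eq)
  show ?thesis
  proof (cases "c = 0")
    case True
    have "a $ S = 0" for S
    proof -
      have "0 = (s *\<^sub>R a + t *\<^sub>R b) $ S" using c True by simp
      then have "s * a $ S + t * b $ S = 0" by simp
      moreover have "0 \<le> s * a $ S" "0 \<le> t * b $ S"
        using supermodular_cone_nonneg[OF ab(1), of S] supermodular_cone_nonneg[OF ab(2), of S] s by auto
      ultimately have "s * a $ S = 0" by linarith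
      then show ?thesis using s by simp
    qed
    then have "a = 0" by (simp add: vec_eq_iff)
    then show ?thesis by (auto simp: conic_hull_singleton_eq)
  next
    case False
    have "m = (1 / c) *\<^sub>R (c *\<^sub>R m)" using False by simp
    also have "\<dots> = (s / c) *\<^sub>R a + (t / c) *\<^sub>R b"
      unfolding c(2)[symmetric] by (simp add: scaleR_right_distrib)
    finally have "(s / c) *\<^sub>R a \<in> conic hull {m}"
      using ab s c(1)
      by (intro summand_is_multiple[OF only \<open>m \<noteq> 0\<close>, of _ "(t / c) *\<^sub>R b"] supermodular_cone_scaleR) auto
    then obtain d where d: "0 \<le> d" "(s / c) *\<^sub>R a = d *\<^sub>R m" by (auto simp: conic_hull_singleton_eq)
    have "a = (c / s) *\<^sub>R ((s / c) *\<^sub>R a)" using s False by simp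
    also have "\<dots> = (c / s * d) *\<^sub>R m" unfolding d(2) by simp
    finally show ?thesis using c(1) s d(1) by (auto simp: conic_hull_singleton_eq)
  qed
qed

lemma extreme_ray_if_solutions_multiples:
  assumes only: "\<And>y. solution y \<Longrightarrow> \<exists>\<alpha>. \<forall>\<tau> i. y $ \<tau> $ i = \<alpha> * x $ \<tau> $ i"
    and "m \<noteq> 0"
  shows "generates_extreme_ray m supermodular_cone"
  unfolding generates_extreme_ray_def face_of_def
proof (intro conjI ballI impI)
  show "m \<noteq> 0" by fact
  show "conic hull {m} \<subseteq> supermodular_cone"
    using supermodular_cone_scaleR[OF m_in_cone] by (auto simp: conic_hull_singleton_eq)
  show "convex (conic hull {m})" by (simp add: convex_conic_hull)
next
  fix a b p
  assume ab: "a \<in> supermodular_cone" "b \<in> supermodular_cone"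
    and p: "p \<in> conic hull {m}" "p \<in> open_segment a b"
  obtain u where u: "0 < u" "u < 1" "p = (1 - u) *\<^sub>R a + u *\<^sub>R b"
    using p(2) unfolding in_segment by blast
  show "a \<in> conic hull {m}"
    using u p(1) summand_of_multiple_is_multiple[OF only \<open>m \<noteq> 0\<close> ab, of "1 - u" u] by simp
  show "b \<in> conic hull {m}"
    using u p(1) summand_of_multiple_is_multiple[OF only \<open>m \<noteq> 0\<close> ab(2,1), of u "1 - u"]
    by (simp add: add.commute)
qed

section \<open>Uniqueness of solutions from extremality\<close>

lemma solution_multiple_if_extreme_ray:
  assumes ray: "generates_extreme_ray m supermodular_cone" and y: "solution y"
  shows "\<exists>\<alpha>. \<forall>\<tau> i. y $ \<tau> $ i = \<alpha> * x $ \<tau> $ i"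
proof -
  \<comment> \<open>Every set is tight at some row, and by (b) the choice of the row does not affect
    the sum.\<close>
  define w :: "'n set_fun" where
    "w = (\<chi> S. \<Sum>i\<in>S. y $ (SOME \<tau>. S \<in> tight_sets m x \<tau>) $ i)"
  have w: "w $ S = (\<Sum>i\<in>S. y $ \<tau> $ i)" if "S \<in> tight_sets m x \<tau>" for S \<tau>
  proof -
    have "S \<in> tight_sets m x (SOME \<tau>. S \<in> tight_sets m x \<tau>)" using that by (rule someI)
    then show ?thesis using solution_sum_eq[OF y _ that] by (simp add: w_def)
  qed
  have w_small: "w $ S = 0" if "card S \<le> 1" for S
  proof (cases "S = {}")
    case False
    then have "0 < card S" by (simp add: card_gt_0_iff)
    then have "card S = 1" using that by linarith
    then obtain i where S: "S = {i}" by (rule card_1_singletonE)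
    obtain \<tau> where "S \<in> tight_sets m x \<tau>" using tight_chain[of S S S] by auto
    moreover from this have "i \<in> null_set x \<tau>" using singleton_tight_iff S by blast
    then have "y $ \<tau> $ i = 0" using y unfolding solution_def by blast
    ultimately show ?thesis using w[of S \<tau>] S by simp
  qed (simp add: w_def)
  \<comment> \<open>\<open>f\<close> and \<open>g\<close> measure the slack of \<open>m\<close> and
    of \<open>w\<close> in the supermodular inequality for a pair of sets.\<close>
  define f where "f = (\<lambda>(A, B). m $ (A \<union> B) + m $ (A \<inter> B) - (m $ A + m $ B))"
  define g where "g = (\<lambda>(A, B). w $ (A \<union> B) + w $ (A \<inter> B) - (w $ A + w $ B))"
  have "g (A, B) = 0" if "f (A, B) = 0" for A B
  proof -
    obtain \<tau> where t: "A \<inter> B \<in> tight_sets m x \<tau>" "A \<in> tight_sets m x \<tau>" "A \<union> B \<in> tight_sets m x \<tau>"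
      using tight_chain[of "A \<inter> B" A "A \<union> B"] by blast
    have modular: "(\<Sum>i\<in>A \<union> B. v $ i) + (\<Sum>i\<in>A \<inter> B. v $ i) = (\<Sum>i\<in>A. v $ i) + (\<Sum>i\<in>B. v $ i)"
      for v :: "real ^ 'n" by (simp add: sum.union_inter)
    have "B \<in> tight_sets m x \<tau>" using t modular[of "x $ \<tau>"] that by (simp add: tight_sets_def f_def)
    then show ?thesis using w t modular[of "y $ \<tau>"] by (simp add: g_def)
  qed
  moreover have "0 \<le> f p" for p using supermod by (auto simp: f_def supermodular_def split: prod.split)
  ultimately obtain \<epsilon> where e: "\<epsilon> > 0" "\<And>p. \<epsilon> * \<bar>g p\<bar> \<le> f p"
    using ex_uniform_scale[of f g] by (metis surj_pair)
  have cone: "m + s *\<^sub>R w \<in> supermodular_cone" if s: "\<bar>s\<bar> = \<epsilon>" for s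
  proof -
    have "(m + s *\<^sub>R w) $ A + (m + s *\<^sub>R w) $ B
        \<le> (m + s *\<^sub>R w) $ (A \<union> B) + (m + s *\<^sub>R w) $ (A \<inter> B)" for A B
    proof -
      have "\<bar>s * g (A, B)\<bar> \<le> f (A, B)" using e(2) s by (simp add: abs_mult)
      then have "0 \<le> f (A, B) + s * g (A, B)" by linarith
      then show ?thesis by (simp add: f_def g_def algebra_simps)
    qed
    moreover have "(m + s *\<^sub>R w) $ S = 0" if "card S \<le> 1" for S
      using w_small[OF that] stand that by (simp add: standardized_def)
    ultimately show ?thesis
      by (auto simp: supermodular_cone_def game_def supermodular_def standardized_def)
  qed
  obtain \<alpha> where \<alpha>: "w = \<alpha> *\<^sub>R m"
  proof (cases "w = 0")
    case True
    then show ?thesis using that[of 0] by simp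
  next
    case False
    \<comment> \<open>As \<open>w\<close> is nonzero these points are distinct with midpoint
      \<open>m\<close>, so the face property puts \<open>?b\<close> on the ray.\<close>
    let ?a = "m + (- \<epsilon>) *\<^sub>R w" and ?b = "m + \<epsilon> *\<^sub>R w"
    have "?b - ?a = (2 * \<epsilon>) *\<^sub>R w" by (simp add: scaleR_2[symmetric])
    then have "?a \<noteq> ?b" using False e(1) by auto
    moreover have "midpoint ?a ?b = m" by (simp add: midpoint_def scaleR_2[symmetric])
    ultimately have "m \<in> open_segment ?a ?b" by (metis midpoint_in_open_segment)
    moreover have "m \<in> conic hull {m}" by (simp add: hull_inc)
    moreover have "?a \<in> supermodular_cone" "?b \<in> supermodular_cone" using cone[of "- \<epsilon>"] cone[of \<epsilon>] e(1) by auto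
    ultimately have "?b \<in> conic hull {m}"
      using ray unfolding generates_extreme_ray_def face_of_def by blast
    then obtain c where "m + \<epsilon> *\<^sub>R w = c *\<^sub>R m" by (auto simp: conic_hull_singleton_eq)
    then have *: "\<epsilon> *\<^sub>R w = (c - 1) *\<^sub>R m" by (simp add: algebra_simps)
    have "w = (1 / \<epsilon>) *\<^sub>R (\<epsilon> *\<^sub>R w)" using e(1) by simp
    also have "\<dots> = ((c - 1) / \<epsilon>) *\<^sub>R m" unfolding * by simp
    finally show ?thesis using that by blast
  qed
  \<comment> \<open>Each row has a full chain of tight segments, on which \<open>w\<close> and
    \<open>m\<close> prescribe the sums of \<open>y\<close> and \<open>x\<close>; these sums
    determine the rows.\<close>
  have "y $ \<tau> = \<alpha> *\<^sub>R x $ \<tau>" for \<tau>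
  proof -
    obtain r :: "'n \<Rightarrow> nat" where r: "inj r" "\<And>k. {j. r j < k} \<in> tight_sets m x \<tau>"
      using tight_rank by blast
    show ?thesis
    proof (rule eq_if_segment_sums_eq[OF r(1)])
      fix k
      show "(\<Sum>i\<in>{j. r j < k}. y $ \<tau> $ i) = (\<Sum>i\<in>{j. r j < k}. (\<alpha> *\<^sub>R x $ \<tau>) $ i)"
        using w[OF r(2)[of k]] r(2)[of k] \<alpha> by (simp add: tight_sets_def sum_distrib_left)
    qed
  qed
  then show ?thesis by auto
qed

end

theorem theorem1:
  fixes m :: "real ^ ('n::finite set)"
    and x :: "real ^ 'n ^ 'g::finite"
  assumes "CARD('n) \<ge> 2"
    and "game m" and "supermodular m" and "standardized m" and "m \<noteq> 0"
    and "rows x = {v. v extreme_point_of core m}"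
  shows "generates_extreme_ray m supermodular_cone \<longleftrightarrow>
    (\<forall>y :: real ^ 'n ^ 'g.
       (\<forall>\<tau>. \<forall>i \<in> null_set x \<tau>. y $ \<tau> $ i = 0) \<and>
       (\<forall>S \<tau> \<pi>. S \<in> tight_sets m x \<tau> \<inter> tight_sets m x \<pi> \<longrightarrow>
          (\<Sum>i\<in>S. y $ \<tau> $ i) = (\<Sum>i\<in>S. y $ \<pi> $ i)) \<longrightarrow>
       (\<exists>\<alpha>::real. \<forall>\<tau> i. y $ \<tau> $ i = \<alpha> * x $ \<tau> $ i))"
proof -
  interpret core_vertices m x by unfold_locales fact+
  show ?thesis
    unfolding solution_def[symmetric]
  proof (intro iffI allI impI)
    show "generates_extreme_ray m supermodular_cone"
      if only: "\<forall>y. solution y \<longrightarrow> (\<exists>\<alpha>. \<forall>\<tau> i. y $ \<tau> $ i = \<alpha> * x $ \<tau> $ i)"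
      using only[rule_format] \<open>m \<noteq> 0\<close> by (rule extreme_ray_if_solutions_multiples)
  qed (rule solution_multiple_if_extreme_ray)
qed

end
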